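(* For every topological space $X$, the following conditions are equivalent. (1) $X$ is $H(i)$. (2) $X$ is weakly initially $\lambda$-compact, for every infinite cardinal $\lambda$. (3) $X$ is $D$-pseudocompact, for every ultrafilter $D$ (over any set). (4) For every infinite cardinal $\lambda$, there exists some regular ultrafilter $D$ over $\lambda$ such that $X$ is $D$-pseudocompact. If $X$ is Hausdorff, then the preceding conditions are also equivalent to: (5) $X$ is $H$-closed. If $X$ is Hausdorff and regular, then the preceding conditions are also equivalent to: (6) $X$ is compact.
   Context: No separation axiom is assumed unless specified. A topological space $X$ is $H(i)$ if and only if every open filter base on $X$ has nonvoid adherence; equivalently, every open cover of $X$ has a finite subset whose union is dense in $X$. A Hausdorff space is $H$-closed (Hausdorff-closed) if and only if it is closed in every Hausdorff space in which it is embedded. For an infinite cardinal $\lambda$, $X$ is weakly initially $\lambda$-compact if and only if every open cover of $X$ of cardinality at most $\lambda$ has a finite subset whose union is dense in $X$. Let $D$ be an ultrafilter over a set $I$. A point $x \in X$ is a $D$-limit point of a sequence $(O_i)_{i \in I}$ of subsets of $X$ if and only if, for every neighborhood $U$ of $x$ in $X$, $\{ i \in I \mid U \cap O_i \neq \emptyset \} \in D$. The space $X$ is $D$-pseudocompact if and only if every $I$-indexed sequence of nonempty open sets of $X$ has some $D$-limit point in $X$. An ultrafilter $D$ over an infinite cardinal $\lambda$ is regular if and only if there is a family of $\lambda$ elements of $D$ such that the intersection of any infinite subset of the family is empty. *)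

theory Defs
  imports "HOL-Analysis.Analysis"
begin

unbundle cardinal_syntax

text \<open>
  HOL cannot quantify over all types inside a formula.  Index sets, cardinals and ambient spaces
  therefore range over the type below.  The parameter \<open>'b\<close> is an arbitrary type, so any given
  set, infinite cardinal or topological space has an isomorphic copy here for a suitable \<open>'b\<close>.
  The summand \<open>nat\<close> provides infinite cardinals, and \<open>'a set\<close> provides
  index sets at least as large as any family of subsets of a space over \<open>'a\<close>.
\<close>

type_synonym ('a, 'b) universe = "nat + 'a set + 'b"

definition infinite_cardinal :: "'i rel \<Rightarrow> bool" where
  "infinite_cardinal l \<longleftrightarrow> Card_order l \<and> infinite (Field l)"

definition open_filter_base :: "'a topology \<Rightarrow> 'a set set \<Rightarrow> bool" where
  "open_filter_base X B \<longleftrightarrow>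
     B \<noteq> {} \<and> (\<forall>U\<in>B. openin X U \<and> U \<noteq> {}) \<and>
     (\<forall>U\<in>B. \<forall>V\<in>B. \<exists>W\<in>B. W \<subseteq> U \<inter> V)"

definition adherence :: "'a topology \<Rightarrow> 'a set set \<Rightarrow> 'a set" where
  "adherence X B = {x \<in> topspace X. \<forall>U\<in>B. x \<in> X closure_of U}"

definition H_i :: "'a topology \<Rightarrow> bool" where
  "H_i X \<longleftrightarrow> (\<forall>B. open_filter_base X B \<longrightarrow> adherence X B \<noteq> {})"

definition weakly_initially_compact :: "'i rel \<Rightarrow> 'a topology \<Rightarrow> bool" where
  "weakly_initially_compact l X \<longleftrightarrow>
     (\<forall>C. (\<forall>U\<in>C. openin X U) \<and> \<Union>C = topspace X \<and> |C| \<le>o l \<longrightarrow>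
        (\<exists>F. F \<subseteq> C \<and> finite F \<and> X closure_of (\<Union>F) = topspace X))"

definition ultrafilter_over :: "'i set \<Rightarrow> 'i set set \<Rightarrow> bool" where
  "ultrafilter_over I D \<longleftrightarrow>
     D \<subseteq> Pow I \<and> I \<in> D \<and> {} \<notin> D \<and>
     (\<forall>A\<in>D. \<forall>B\<in>D. A \<inter> B \<in> D) \<and>
     (\<forall>A\<in>D. \<forall>B. A \<subseteq> B \<and> B \<subseteq> I \<longrightarrow> B \<in> D) \<and>
     (\<forall>A. A \<subseteq> I \<longrightarrow> A \<in> D \<or> I - A \<in> D)"

text \<open>A cardinal is a well-order relation, and its underlying set is its field.\<close>

definition regular_ultrafilter_over :: "'i rel \<Rightarrow> 'i set set \<Rightarrow> bool" where
  "regular_ultrafilter_over l D \<longleftrightarrow>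
     ultrafilter_over (Field l) D \<and>
     (\<exists>Z. Z \<subseteq> D \<and> |Z| =o l \<and> (\<forall>S. S \<subseteq> Z \<and> infinite S \<longrightarrow> \<Inter>S = {}))"

definition neighborhood :: "'a topology \<Rightarrow> 'a \<Rightarrow> 'a set \<Rightarrow> bool" where
  "neighborhood X x U \<longleftrightarrow> U \<subseteq> topspace X \<and> (\<exists>V. openin X V \<and> x \<in> V \<and> V \<subseteq> U)"

definition D_limit_point ::
    "'i set \<Rightarrow> 'i set set \<Rightarrow> 'a topology \<Rightarrow> ('i \<Rightarrow> 'a set) \<Rightarrow> 'a \<Rightarrow> bool" where
  "D_limit_point I D X Os x \<longleftrightarrow>
     x \<in> topspace X \<and> (\<forall>U. neighborhood X x U \<longrightarrow> {i \<in> I. U \<inter> Os i \<noteq> {}} \<in> D)"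

definition D_pseudocompact :: "'i set \<Rightarrow> 'i set set \<Rightarrow> 'a topology \<Rightarrow> bool" where
  "D_pseudocompact I D X \<longleftrightarrow>
     (\<forall>Os. (\<forall>i\<in>I. openin X (Os i) \<and> Os i \<noteq> {}) \<longrightarrow> (\<exists>x. D_limit_point I D X Os x))"

text \<open>The ambient Hausdorff spaces have points in the type \<open>'u\<close>, which must be large enough
  to hold a copy of the space and one further point, as the type \<open>universe\<close> is.\<close>

definition H_closed :: "'u itself \<Rightarrow> 'a topology \<Rightarrow> bool" where
  "H_closed _ X \<longleftrightarrow>
     Hausdorff_space X \<and>
     (\<forall>(Y :: 'u topology) f.
        Hausdorff_space Y \<and> embedding_map X Y f \<longrightarrow> closedin Y (f ` topspace X))"

end

theory Submission
  imports Defs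
begin

text \<open>
  An open filter base $B$ with empty adherence is turned into each of the other failures.
  The complements of the closures of its members form an open cover without a finite subfamily
  of dense union. If $D$ is regular over a cardinal that is at least $|B|$, attach to the members
  of $B$ distinct sets of the regular family: every index $i$ lies in only finitely many of them, so
  one can choose $O_i \in B$ inside all the corresponding members, and a $D$-limit point of
  $(O_i)$ would be adherent to $B$. Finally, adding to $X$ one point with the traces of $B$ as
  neighbourhoods gives a Hausdorff space in which $X$ is not closed.
\<close>

section \<open>Ultrafilters with prescribed members, and regular ultrafilters\<close>

text \<open>Zorn's lemma gives a maximal family \<open>D\<close> among those containing
  \<open>A\<close> whose finite intersections meet \<open>I\<close>. Maximality yields one
  membership criterion, \<open>mem\<close>, from which most of the ultrafilter axioms are read
  off.\<close>

lemma ultrafilter_extension: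
  assumes A: "A \<subseteq> Pow I" and fip: "\<And>F. F \<subseteq> A \<Longrightarrow> finite F \<Longrightarrow> I \<inter> \<Inter>F \<noteq> {}"
  obtains D where "ultrafilter_over I D" "A \<subseteq> D"
proof -
  define P where "P = {M. A \<subseteq> M \<and> M \<subseteq> Pow I \<and> (\<forall>F. F \<subseteq> M \<and> finite F \<longrightarrow> I \<inter> \<Inter>F \<noteq> {})}"
  have "A \<in> P"
    using assms by (auto simp: P_def)
  have "\<exists>M\<in>P. \<forall>X\<in>P. M \<subseteq> X \<longrightarrow> X = M"
  proof (rule subset_Zorn_nonempty)
    show "P \<noteq> {}"
      using \<open>A \<in> P\<close> by blast
    fix C assume C: "C \<noteq> {}" "subset.chain P C"
    then have "C \<subseteq> P"
      by (auto simp: subset.chain_def)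
    have "I \<inter> \<Inter>F \<noteq> {}" if F: "F \<subseteq> \<Union>C" "finite F" for F
    proof -
      obtain M where "M \<in> C" "F \<subseteq> M"
        using finite_subset_Union_chain[OF F(2,1) C] by blast
      then show ?thesis
        using \<open>C \<subseteq> P\<close> F(2) by (auto simp: P_def)
    qed
    moreover have "A \<subseteq> \<Union>C" "\<Union>C \<subseteq> Pow I"
      using C(1) \<open>C \<subseteq> P\<close> by (fastforce simp: P_def)+
    ultimately show "\<Union>C \<in> P"
      by (auto simp: P_def)
  qed
  then obtain D where "D \<in> P" and max: "\<And>X. X \<in> P \<Longrightarrow> D \<subseteq> X \<Longrightarrow> X = D"
    by blast
  then have AD: "A \<subseteq> D" and DI: "D \<subseteq> Pow I"
    and D: "\<And>F. F \<subseteq> D \<Longrightarrow> finite F \<Longrightarrow> I \<inter> \<Inter>F \<noteq> {}"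
    by (auto simp: P_def)
  \<comment> \<open>A set \<open>S\<close> meeting every finite intersection of members of
    \<open>D\<close> can be adjoined to \<open>D\<close> without leaving \<open>P\<close>, so by
    maximality it is already there.\<close>
  have mem: "S \<in> D" if "S \<subseteq> I" and S: "\<And>F. F \<subseteq> D \<Longrightarrow> finite F \<Longrightarrow> S \<inter> \<Inter>F \<noteq> {}" for S
  proof -
    have "I \<inter> \<Inter>F \<noteq> {}" if F: "F \<subseteq> insert S D" "finite F" for F
    proof -
      have "S \<inter> \<Inter>(F - {S}) \<noteq> {}"
        using F by (intro S) auto
      then show ?thesis
        using \<open>S \<subseteq> I\<close> by blast
    qed
    then have "insert S D \<in> P"
      using AD DI \<open>S \<subseteq> I\<close> by (auto simp: P_def)
    then show ?thesis
      using max[of "insert S D"] by blast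
  qed
  have "I \<in> D"
    using D by (intro mem) auto
  moreover have "{} \<notin> D"
    using D[of "{{}}"] by auto
  moreover have "S \<inter> T \<in> D" if "S \<in> D" "T \<in> D" for S T
  proof (rule mem)
    show "S \<inter> T \<subseteq> I"
      using that DI by auto
    fix F assume "F \<subseteq> D" "finite F"
    then show "S \<inter> T \<inter> \<Inter>F \<noteq> {}"
      using D[of "{S, T} \<union> F"] that by auto
  qed
  moreover have "T \<in> D" if "S \<in> D" "S \<subseteq> T" "T \<subseteq> I" for S T
  proof (rule mem)
    fix F assume "F \<subseteq> D" "finite F"
    then show "T \<inter> \<Inter>F \<noteq> {}"
      using D[of "insert S F"] that by auto
  qed (use that in auto)
  \<comment> \<open>If both fail the criterion, finite \<open>F\<close> and \<open>G\<close> witness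
    this, and no point of \<open>I\<close> can lie in all members of \<open>F \<union> G\<close>,
    whether it is in \<open>S\<close> or not.\<close>
  moreover have "S \<in> D \<or> I - S \<in> D" if "S \<subseteq> I" for S
  proof (rule ccontr)
    assume "\<not> ?thesis"
    then obtain F G where "F \<subseteq> D" "finite F" "S \<inter> \<Inter>F = {}"
      "G \<subseteq> D" "finite G" "(I - S) \<inter> \<Inter>G = {}"
      using mem[of S] mem[of "I - S"] \<open>S \<subseteq> I\<close> by blast
    then show False
      using D[of "F \<union> G"] by (simp add: Inter_Un_distrib) blast
  qed
  ultimately have "ultrafilter_over I D"
    using DI unfolding ultrafilter_over_def by (intro conjI ballI allI impI; blast)
  with AD show ?thesis
    using that by blast
qed

text \<open>Stratify the finite subsets by size. Each layer is covered by inserting one element into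
  sets of the previous layer, so by induction it has at most \<open>|I|\<close> elements; a
  countable union of such layers is no larger, since \<open>I\<close> is infinite.\<close>

lemma card_of_Fpow_ordLeq_infinite:
  assumes I: "infinite I"
  shows "|Fpow I| \<le>o |I|"
proof -
  define S where "S n = {F \<in> Fpow I. card F = n}" for n
  have "|S n| \<le>o |I|" for n
  proof (induction n)
    case 0
    have "S 0 \<subseteq> {{}}"
      by (auto simp: S_def Fpow_def)
    then have "finite (S 0)"
      using finite_subset by blast
    then show ?case
      using I card_of_ordLeq_infinite ordLeq_total[OF card_of_Well_order card_of_Well_order] by blast
  next
    case (Suc n)
    have "S (Suc n) \<subseteq> (\<lambda>(a, F). insert a F) ` (I \<times> S n)"
    proof
      fix F assume F: "F \<in> S (Suc n)"
      then obtain a G where "F = insert a G" "a \<notin> G" "card G = n"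
        by (auto simp: S_def card_Suc_eq)
      then show "F \<in> (\<lambda>(a, F). insert a F) ` (I \<times> S n)"
        using F by (auto simp: S_def Fpow_def intro!: image_eqI[of _ _ "(a, G)"])
    qed
    then have "|S (Suc n)| \<le>o |I \<times> S n|"
      by (meson card_of_image card_of_mono1 ordLeq_transitive)
    then show ?case
      using card_of_Sigma_ordLeq_infinite[OF I, of I "\<lambda>_. S n"] I Suc ordLeq_transitive
        ordIso_imp_ordLeq[OF card_of_refl] by blast
  qed
  then have "|\<Union>n. S n| \<le>o |I|"
    using I infinite_iff_card_of_nat by (intro card_of_UNION_ordLeq_infinite) auto
  moreover have "Fpow I = (\<Union>n. S n)"
    by (auto simp: S_def)
  ultimately show ?thesis
    by simp
qed

text \<open>Let the index set enumerate its finite subsets; the regular family consists of the sets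
  of all indices whose finite subset contains a given element.\<close>

lemma regular_ultrafilter_exists:
  assumes "infinite_cardinal l"
  obtains D where "regular_ultrafilter_over l D"
proof -
  define I where "I = Field l"
  have "infinite I" and Il: "|I| =o l"
    using assms card_of_Field_ordIso by (auto simp: infinite_cardinal_def I_def)
  then obtain h where h: "h ` I = Fpow I"
    using card_of_ordLeq2[OF Fpow_not_empty] card_of_Fpow_ordLeq_infinite by metis
  define Z where "Z a = {i \<in> I. a \<in> h i}" for a
  have ex: "\<exists>i\<in>I. h i = F" if "F \<subseteq> I" "finite F" for F
  proof -
    have "F \<in> h ` I"
      using that by (simp add: h Fpow_def)
    then show ?thesis
      by blast
  qed
  have fin: "finite (h i)" if "i \<in> I" for i
    using imageI[OF that, of h] by (simp add: h Fpow_def)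
  \<comment> \<open>An index enumerating the singleton of \<open>a\<close> lies in
    \<open>Z a\<close> and in no other \<open>Z b\<close>. Injectivity gives the family exactly the
    cardinality \<open>l\<close>.\<close>
  have "inj_on Z I"
  proof (rule inj_onI)
    fix a b assume ab: "a \<in> I" "b \<in> I" "Z a = Z b"
    obtain i where "i \<in> I" "h i = {a}"
      using ex[of "{a}"] ab by auto
    then show "a = b"
      using ab(3) by (auto simp: Z_def)
  qed
  then have card: "|Z ` I| =o l"
    using card_of_ordIsoI[of Z I] Il inj_on_imp_bij_betw ordIso_symmetric ordIso_transitive by metis
  \<comment> \<open>The index that enumerates a finite set \<open>G\<close> lies in
    \<open>Z a\<close> for every \<open>a\<close> in \<open>G\<close>.\<close>
  have "I \<inter> \<Inter>F \<noteq> {}" if F: "F \<subseteq> Z ` I" "finite F" for F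
  proof -
    obtain G where G: "G \<subseteq> I" "finite G" "F = Z ` G"
      using finite_subset_image[OF F(2,1)] by blast
    obtain i where "i \<in> I" "h i = G"
      using ex G by blast
    then have "i \<in> I \<inter> \<Inter>F"
      using G by (auto simp: Z_def)
    then show ?thesis
      by blast
  qed
  moreover have "Z ` I \<subseteq> Pow I"
    by (auto simp: Z_def)
  ultimately obtain D where D: "ultrafilter_over I D" "Z ` I \<subseteq> D"
    using ultrafilter_extension by metis
  \<comment> \<open>A common point \<open>i\<close> of infinitely many sets \<open>Z a\<close> would
    force infinitely many elements into the finite set \<open>h i\<close>.\<close>
  have "\<Inter>S = {}" if S: "S \<subseteq> Z ` I" "infinite S" for S
  proof (rule ccontr)
    assume "\<Inter>S \<noteq> {}"
    then obtain i where i: "\<And>s. s \<in> S \<Longrightarrow> i \<in> s"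
      by blast
    obtain T where T: "T \<subseteq> I" "S = Z ` T"
      using S(1) by (rule subset_imageE)
    then have "infinite T"
      using S(2) by auto
    moreover have "i \<in> I" "T \<subseteq> h i"
      using i T S(2) by (auto simp: Z_def dest!: infinite_imp_nonempty)
    ultimately show False
      using fin finite_subset by blast
  qed
  then have "regular_ultrafilter_over l D"
    using D card unfolding regular_ultrafilter_over_def I_def
    by (intro conjI exI[of _ "Z ` Field l"]) auto
  then show ?thesis
    using that by blast
qed

section \<open>Open filter bases and finite subfamilies with dense union\<close>

lemma open_filter_base_finite_Inter:
  assumes B: "open_filter_base X B" and "finite F" "F \<subseteq> B"
  shows "\<exists>W\<in>B. \<forall>U\<in>F. W \<subseteq> U"
  using assms(2,3)
proof (induction F)
  case empty
  then show ?case
    using B by (auto simp: open_filter_base_def)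
next
  case (insert U F)
  then obtain V where "V \<in> B" "\<forall>U\<in>F. V \<subseteq> U"
    by auto
  moreover obtain W where "W \<in> B" "W \<subseteq> U \<inter> V"
    using B insert.prems \<open>V \<in> B\<close> unfolding open_filter_base_def by blast
  ultimately show ?case
    by blast
qed

text \<open>The filter bases constructed below are indexed: by the finite subfamilies of a cover, by
  the members of an ultrafilter, and by the open neighbourhoods of a point.\<close>

lemma open_filter_base_image:
  assumes "A \<noteq> {}" "\<And>a. a \<in> A \<Longrightarrow> openin X (u a) \<and> u a \<noteq> {}"
    and "\<And>a b. a \<in> A \<Longrightarrow> b \<in> A \<Longrightarrow> \<exists>c\<in>A. u c \<subseteq> u a \<inter> u b"
  shows "open_filter_base X (u ` A)"
  using assms by (simp add: open_filter_base_def)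

lemma H_i_obtains_adherent_point:
  assumes "H_i X" "open_filter_base X B"
  obtains x where "x \<in> topspace X" "\<And>U. U \<in> B \<Longrightarrow> x \<in> X closure_of U"
proof -
  have "adherence X B \<noteq> {}"
    using assms by (simp add: H_i_def)
  then show ?thesis
    using that by (auto simp: adherence_def)
qed

text \<open>If no finite subfamily had dense union, the exteriors \<open>c F\<close> of the finite
  unions would form an open filter base. An adherent point would lie in some \<open>U\<close> of the
  cover, but \<open>U\<close> misses the exterior of \<open>U\<close>.\<close>

lemma H_i_finite_dense_subcover:
  assumes "H_i X" and op: "\<And>U. U \<in> C \<Longrightarrow> openin X U" and cover: "\<Union>C = topspace X"
  shows "\<exists>F\<subseteq>C. finite F \<and> X closure_of (\<Union>F) = topspace X"
proof (rule ccontr)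
  assume not: "\<not> ?thesis"
  define c where "c F = topspace X - X closure_of (\<Union>F)" for F
  define B where "B = c ` {F. F \<subseteq> C \<and> finite F}"
  have "open_filter_base X B"
    unfolding B_def
  proof (rule open_filter_base_image)
    show "openin X (c F) \<and> c F \<noteq> {}" if "F \<in> {F. F \<subseteq> C \<and> finite F}" for F
    proof -
      have "X closure_of (\<Union>F) \<noteq> topspace X"
        using that not by blast
      then have "\<not> topspace X \<subseteq> X closure_of (\<Union>F)"
        using closure_of_subset_topspace by (metis subset_antisym)
      then show ?thesis
        by (simp add: c_def openin_diff)
    qed
    show "\<exists>H\<in>{F. F \<subseteq> C \<and> finite F}. c H \<subseteq> c F \<inter> c G"
      if "F \<in> {F. F \<subseteq> C \<and> finite F}" "G \<in> {F. F \<subseteq> C \<and> finite F}" for F G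
      using that by (intro bexI[of _ "F \<union> G"]) (auto simp: c_def)
  qed blast
  then obtain x where x: "x \<in> topspace X" "\<And>U. U \<in> B \<Longrightarrow> x \<in> X closure_of U"
    using H_i_obtains_adherent_point[OF \<open>H_i X\<close>] by blast
  obtain U where U: "U \<in> C" "x \<in> U"
    using x(1) cover by auto
  then have "x \<in> X closure_of (c {U})"
    by (intro x(2)) (auto simp: B_def)
  moreover have "U \<inter> c {U} = {}"
    using closure_of_subset[OF openin_subset[OF op[OF U(1)]]] by (auto simp: c_def)
  ultimately show False
    using U op[OF U(1)] openin_Int_closure_of_eq_empty by blast
qed

text \<open>One cardinal suffices, provided that it bounds every family of subsets of the
  space.\<close>

lemma weakly_initially_compact_imp_H_i:
  fixes X :: "'a topology" and l :: "'i rel"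
  assumes "weakly_initially_compact l X" and l: "|UNIV :: 'a set set| \<le>o l"
  shows "H_i X"
proof (rule ccontr)
  assume "\<not> H_i X"
  then obtain B where B: "open_filter_base X B" and adh: "adherence X B = {}"
    by (auto simp: H_i_def)
  define c where "c U = topspace X - X closure_of U" for U
  have "\<Union>(c ` B) = topspace X"
    using adh by (auto simp: c_def adherence_def)
  moreover have "|c ` B| \<le>o l"
    using l by (meson card_of_mono1 ordLeq_transitive subset_UNIV)
  moreover have "\<forall>U\<in>c ` B. openin X U"
    by (auto simp: c_def)
  ultimately obtain F where F: "F \<subseteq> c ` B" "finite F" "X closure_of (\<Union>F) = topspace X"
    using assms(1)[unfolded weakly_initially_compact_def, rule_format, of "c ` B"] by metis
  obtain G where G: "G \<subseteq> B" "finite G" "F = c ` G"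
    using finite_subset_image[OF F(2,1)] by blast
  then obtain W where W: "W \<in> B" "\<And>U. U \<in> G \<Longrightarrow> W \<subseteq> U"
    using open_filter_base_finite_Inter[OF B] by metis
  then have op: "openin X W" "W \<noteq> {}"
    using B by (auto simp: open_filter_base_def)
  \<comment> \<open>Since \<open>W\<close> lies below the finitely many members of \<open>B\<close>
    involved, it misses all their exteriors. A nonempty open set cannot miss a dense union.\<close>
  have "W \<inter> c U = {}" if "U \<in> G" for U
    using W(2)[OF that] op(1) closure_of_mono[of W U X] closure_of_subset[OF openin_subset[OF op(1)]]
    by (auto simp: c_def)
  then have "W \<inter> \<Union>F = {}"
    using G by auto
  then have "W \<inter> topspace X = {}"
    using op(1) F(3) openin_Int_closure_of_eq_empty by metis
  then show False
    using op openin_subset by blast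
qed

section \<open>Pseudocompactness relative to ultrafilters\<close>

text \<open>The unions \<open>u A\<close> of the given open sets over the members \<open>A\<close>
  of \<open>D\<close> form an open filter base, and any adherent point is a \<open>D\<close>-limit
  point: if the indices whose set meets a neighbourhood \<open>U\<close> were not in
  \<open>D\<close>, their complement would be, and \<open>U\<close> would miss the union over
  it.\<close>

lemma H_i_imp_D_pseudocompact:
  assumes "H_i X" and D: "ultrafilter_over I D"
  shows "D_pseudocompact I D X"
  unfolding D_pseudocompact_def
proof (intro allI impI)
  fix Os assume Os: "\<forall>i\<in>I. openin X (Os i) \<and> Os i \<noteq> {}"
  have D': "D \<subseteq> Pow I" "I \<in> D" "{} \<notin> D" "\<And>A B. A \<in> D \<Longrightarrow> B \<in> D \<Longrightarrow> A \<inter> B \<in> D"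
    "\<And>A. A \<subseteq> I \<Longrightarrow> A \<in> D \<or> I - A \<in> D"
    using D by (auto simp: ultrafilter_over_def)
  define u where "u A = \<Union>(Os ` A)" for A
  have "open_filter_base X (u ` D)"
  proof (rule open_filter_base_image)
    show "openin X (u A) \<and> u A \<noteq> {}" if "A \<in> D" for A
    proof -
      have "A \<subseteq> I" "A \<noteq> {}"
        using that D' by auto
      then show ?thesis
        using Os by (fastforce simp: u_def)
    qed
    show "\<exists>E\<in>D. u E \<subseteq> u A \<inter> u A'" if "A \<in> D" "A' \<in> D" for A A'
      using that D'(4) by (intro bexI[of _ "A \<inter> A'"]) (auto simp: u_def)
  qed (use D'(2) in blast)
  then obtain x where x: "x \<in> topspace X" "\<And>A. A \<in> D \<Longrightarrow> x \<in> X closure_of (u A)"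
    by (auto elim: H_i_obtains_adherent_point[OF \<open>H_i X\<close>])
  have "{i \<in> I. U \<inter> Os i \<noteq> {}} \<in> D" if U: "neighborhood X x U" for U
  proof (rule ccontr)
    assume "\<not> ?thesis"
    then have "I - {i \<in> I. U \<inter> Os i \<noteq> {}} \<in> D"
      using D'(5)[of "{i \<in> I. U \<inter> Os i \<noteq> {}}"] by auto
    then have "x \<in> X closure_of (u (I - {i \<in> I. U \<inter> Os i \<noteq> {}}))"
      by (rule x(2))
    moreover obtain V where "openin X V" "x \<in> V" "V \<subseteq> U"
      using U unfolding neighborhood_def by blast
    ultimately show False
      by (auto simp: in_closure_of u_def)
  qed
  then show "\<exists>x. D_limit_point I D X Os x"
    using x(1) unfolding D_limit_point_def by blast
qed

lemma regular_D_pseudocompact_imp_H_i: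
  fixes X :: "'a topology" and l :: "'i rel"
  assumes D: "regular_ultrafilter_over l D" and pc: "D_pseudocompact (Field l) D X"
    and l: "|UNIV :: 'a set set| \<le>o l"
  shows "H_i X"
  unfolding H_i_def
proof (intro allI impI)
  fix B assume B: "open_filter_base X B"
  obtain Z where Z: "Z \<subseteq> D" "|Z| =o l" "\<And>S. S \<subseteq> Z \<Longrightarrow> infinite S \<Longrightarrow> \<Inter>S = {}"
    using D unfolding regular_ultrafilter_over_def by metis
  have int: "A \<inter> A' \<noteq> {}" if "A \<in> D" "A' \<in> D" for A A'
    using D that unfolding regular_ultrafilter_over_def ultrafilter_over_def by metis
  have "|B| \<le>o |Z|"
    using l Z(2) by (meson card_of_mono1 ordLeq_transitive ordIso_symmetric ordLeq_ordIso_trans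
        subset_UNIV)
  then obtain g where g: "inj_on g B" "g ` B \<subseteq> Z"
    using card_of_ordLeq by metis
  \<comment> \<open>Otherwise, as \<open>g\<close> is injective, \<open>i\<close> would be a common
    point of infinitely many members of the regular family.\<close>
  have "finite {U \<in> B. i \<in> g U}" for i
  proof (rule ccontr)
    assume "infinite {U \<in> B. i \<in> g U}"
    then have "infinite (g ` {U \<in> B. i \<in> g U})"
      using g(1) by (metis (no_types, lifting) finite_imageD inj_on_subset mem_Collect_eq subsetI)
    then have "\<Inter>(g ` {U \<in> B. i \<in> g U}) = {}"
      using g(2) by (intro Z(3)) auto
    then show False
      by auto
  qed
  then have "\<exists>W\<in>B. \<forall>U\<in>{U \<in> B. i \<in> g U}. W \<subseteq> U" for i
    by (intro open_filter_base_finite_Inter[OF B]) auto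
  then have "\<exists>W. W \<in> B \<and> (\<forall>U\<in>B. i \<in> g U \<longrightarrow> W \<subseteq> U)" for i
    by fast
  then obtain Os where Os: "\<And>i. Os i \<in> B" "\<And>i U. U \<in> B \<Longrightarrow> i \<in> g U \<Longrightarrow> Os i \<subseteq> U"
    by metis
  have "\<forall>i\<in>Field l. openin X (Os i) \<and> Os i \<noteq> {}"
    using Os(1) B by (auto simp: open_filter_base_def)
  then obtain x where x: "D_limit_point (Field l) D X Os x"
    using pc unfolding D_pseudocompact_def by blast
  then have xX: "x \<in> topspace X"
    by (auto simp: D_limit_point_def)
  have "x \<in> X closure_of U" if U: "U \<in> B" for U
    unfolding in_closure_of
  proof (intro conjI allI impI xX)
    fix T assume T: "x \<in> T \<and> openin X T"
    then have "neighborhood X x T"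
      using openin_subset unfolding neighborhood_def by blast
    then have "{i \<in> Field l. T \<inter> Os i \<noteq> {}} \<in> D"
      using x by (auto simp: D_limit_point_def)
    \<comment> \<open>Two members of \<open>D\<close> share an index \<open>i\<close>: there
      \<open>Os i\<close> meets \<open>T\<close>, and \<open>i \<in> g U\<close> forces
      \<open>Os i\<close> to lie inside \<open>U\<close>.\<close>
    moreover have "g U \<in> D"
      using g(2) Z(1) U by auto
    ultimately obtain i where "T \<inter> Os i \<noteq> {}" "i \<in> g U"
      using int by blast
    then show "\<exists>y. y \<in> U \<and> y \<in> T"
      using Os(2)[OF U] by blast
  qed
  then show "adherence X B \<noteq> {}"
    using xX by (auto simp: adherence_def)
qed

section \<open>Closedness in Hausdorff spaces\<close>

text \<open>If \<open>y\<close> is in the closure of the image but not in the image, the preimages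
  of its open neighbourhoods form an open filter base. For an adherent point \<open>x\<close>,
  separating \<open>f x\<close> from \<open>y\<close> gives an open set around \<open>x\<close> that
  is disjoint from one of these preimages.\<close>

lemma H_i_imp_closedin_continuous_image:
  assumes "H_i X" and Y: "Hausdorff_space Y" and cont: "continuous_map X Y f"
  shows "closedin Y (f ` topspace X)"
proof -
  have fY: "f ` topspace X \<subseteq> topspace Y"
    using cont by (rule continuous_map_image_subset_topspace)
  have "y \<in> f ` topspace X" if y: "y \<in> Y closure_of (f ` topspace X)" for y
  proof (rule ccontr)
    assume ny: "y \<notin> f ` topspace X"
    have yY: "y \<in> topspace Y"
      using y by (simp add: in_closure_of)
    define p where "p V = {x \<in> topspace X. f x \<in> V}" for V
    define B where "B = p ` {V. openin Y V \<and> y \<in> V}"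
    have p: "openin X (p V)" "p V \<noteq> {}" if "openin Y V" "y \<in> V" for V
      using that y openin_continuous_map_preimage[OF cont] by (auto simp: p_def in_closure_of)
    have "open_filter_base X B"
      unfolding B_def
    proof (rule open_filter_base_image)
      show "{V. openin Y V \<and> y \<in> V} \<noteq> {}"
        using yY by blast
      show "\<exists>T\<in>{V. openin Y V \<and> y \<in> V}. p T \<subseteq> p V \<inter> p W"
        if "V \<in> {V. openin Y V \<and> y \<in> V}" "W \<in> {V. openin Y V \<and> y \<in> V}" for V W
        using that by (intro bexI[of _ "V \<inter> W"]) (auto simp: p_def)
    qed (use p in blast)
    then obtain x where x: "x \<in> topspace X" "\<And>U. U \<in> B \<Longrightarrow> x \<in> X closure_of U"
      using H_i_obtains_adherent_point[OF \<open>H_i X\<close>] by blast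
    have "f x \<in> topspace Y" "f x \<noteq> y"
      using x(1) fY ny by auto
    then obtain U V where UV: "openin Y U" "openin Y V" "f x \<in> U" "y \<in> V" "disjnt U V"
      using Y yY unfolding Hausdorff_space_def by metis
    have "x \<in> X closure_of (p V)"
      using UV by (intro x(2)) (auto simp: B_def)
    moreover have "openin X (p U)" "x \<in> p U"
      using UV x(1) openin_continuous_map_preimage[OF cont] by (auto simp: p_def)
    moreover have "p U \<inter> p V = {}"
      using UV(5) by (auto simp: p_def disjnt_def)
    ultimately show False
      using openin_Int_closure_of_eq_empty by blast
  qed
  then show ?thesis
    using closure_of_subset_eq[of "f ` topspace X" Y] fY by blast
qed

text \<open>The map \<open>e\<close> places a copy of the space in the ambient type, and
  \<open>w\<close> is the added point. Empty adherence of \<open>B\<close> separates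
  \<open>w\<close> from the other points; nonempty members of \<open>B\<close> keep \<open>w\<close>
  from being isolated.\<close>

lemma H_closed_imp_H_i:
  fixes X :: "'a topology" and e :: "'a \<Rightarrow> 'u" and w :: 'u
  assumes closed: "H_closed TYPE('u) X" and inj: "inj e" and w: "w \<notin> range e"
  shows "H_i X"
proof (rule ccontr)
  assume "\<not> H_i X"
  then obtain B where B: "open_filter_base X B" and adh: "adherence X B = {}"
    by (auto simp: H_i_def)
  have X: "Hausdorff_space X"
    using closed by (simp add: H_closed_def)
  have Bne: "B \<noteq> {}" and Bop: "\<And>U. U \<in> B \<Longrightarrow> openin X U" and Bn: "\<And>U. U \<in> B \<Longrightarrow> U \<noteq> {}"
    and Bint: "\<And>U V. U \<in> B \<Longrightarrow> V \<in> B \<Longrightarrow> \<exists>W\<in>B. W \<subseteq> U \<inter> V"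
    using B by (auto simp: open_filter_base_def)
  have ew: "e x \<noteq> w" for x
    using w by auto
  \<comment> \<open>The preimage under \<open>e\<close> is the trace on the space, since
    \<open>w\<close> is outside the range of \<open>e\<close>. A set containing \<open>w\<close>
    must have a trace that includes a member of \<open>B\<close>.\<close>
  define opn where "opn S \<longleftrightarrow> S \<subseteq> insert w (e ` topspace X) \<and> openin X (e -` S) \<and>
      (w \<in> S \<longrightarrow> (\<exists>U\<in>B. U \<subseteq> e -` S))" for S
  have "istopology opn"
    unfolding istopology_def
  proof (intro conjI allI impI)
    fix S T assume S: "opn S" and T: "opn T"
    have "\<exists>U\<in>B. U \<subseteq> e -` (S \<inter> T)" if "w \<in> S \<inter> T"
    proof -
      obtain U V where UV: "U \<in> B" "V \<in> B" "U \<subseteq> e -` S" "V \<subseteq> e -` T"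
        using S T \<open>w \<in> S \<inter> T\<close> unfolding opn_def by blast
      then obtain W where "W \<in> B" "W \<subseteq> U \<inter> V"
        using Bint by blast
      with UV show ?thesis
        by blast
    qed
    then show "opn (S \<inter> T)"
      using S T unfolding opn_def by auto
  next
    fix K assume K: "\<forall>S\<in>K. opn S"
    have "openin X (e -` \<Union>K)"
      unfolding vimage_Union using K by (auto simp: opn_def)
    moreover have "\<exists>U\<in>B. U \<subseteq> e -` \<Union>K" if wK: "w \<in> \<Union>K"
    proof -
      obtain S where "S \<in> K" "w \<in> S"
        using wK by blast
      moreover then obtain U where "U \<in> B" "U \<subseteq> e -` S"
        using K unfolding opn_def by blast
      ultimately show ?thesis
        by blast
    qed
    moreover have "\<Union>K \<subseteq> insert w (e ` topspace X)"
      using K unfolding opn_def by blast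
    ultimately show "opn (\<Union>K)"
      unfolding opn_def by blast
  qed
  define Y where "Y = topology opn"
  have Yop: "openin Y S \<longleftrightarrow> opn S" for S
    unfolding Y_def using \<open>istopology opn\<close> by (simp add: topology_inverse')
  have pre_img: "e -` (e ` U) = U" "e -` insert w (e ` U) = U" for U
    using inj ew by (auto simp: inj_eq)
  have op_img: "openin Y (e ` U)" if "openin X U" for U
    using that openin_subset[OF that] ew unfolding Yop opn_def pre_img by auto
  have op_ins: "openin Y (insert w (e ` U))" if "openin X U" "V \<in> B" "V \<subseteq> U" for U V
    using that openin_subset[OF that(1)] unfolding Yop opn_def pre_img by auto
  have topY: "topspace Y = insert w (e ` topspace X)"
  proof
    show "topspace Y \<subseteq> insert w (e ` topspace X)"
      using openin_topspace[of Y] unfolding Yop opn_def by blast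
    show "insert w (e ` topspace X) \<subseteq> topspace Y"
    proof -
      obtain V where "V \<in> B"
        using Bne by blast
      then show ?thesis
        using Bop openin_subset by (intro openin_subset op_ins[of _ V]) auto
    qed
  qed
  \<comment> \<open>As \<open>x\<close> is not adherent to \<open>B\<close>, some \<open>W\<close>
    in \<open>B\<close> has \<open>x\<close> in its exterior; that exterior and \<open>W\<close>
    together with \<open>w\<close> are the disjoint neighbourhoods.\<close>
  have sep_w: "\<exists>U V. openin Y U \<and> openin Y V \<and> e x \<in> U \<and> w \<in> V \<and> disjnt U V"
    if x: "x \<in> topspace X" for x
  proof -
    obtain W where W: "W \<in> B" "x \<notin> X closure_of W"
      using adh x by (auto simp: adherence_def)
    have "openin Y (e ` (topspace X - X closure_of W))"
      by (intro op_img) auto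
    moreover have "openin Y (insert w (e ` W))"
      using W Bop by (intro op_ins[of W W]) auto
    moreover have "disjnt (e ` (topspace X - X closure_of W)) (insert w (e ` W))"
      using inj ew closure_of_subset[OF openin_subset[OF Bop[OF W(1)]]]
      by (auto simp: disjnt_def inj_eq)
    ultimately show ?thesis
      using x W by blast
  qed
  have "Hausdorff_space Y"
    unfolding Hausdorff_space_def
  proof (intro allI impI)
    fix y z assume yz: "y \<in> topspace Y \<and> z \<in> topspace Y \<and> y \<noteq> z"
    then consider a where "a \<in> topspace X" "y = e a" "z = w"
      | b where "b \<in> topspace X" "z = e b" "y = w"
      | a b where "a \<in> topspace X" "b \<in> topspace X" "y = e a" "z = e b" "a \<noteq> b"
      unfolding topY by blast
    then show "\<exists>U V. openin Y U \<and> openin Y V \<and> y \<in> U \<and> z \<in> V \<and> disjnt U V"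
    proof cases
      case 1
      then show ?thesis
        using sep_w by blast
    next
      case 2
      then show ?thesis
        using sep_w disjnt_sym by metis
    next
      case 3
      then obtain U V where "openin X U" "openin X V" "a \<in> U" "b \<in> V" "disjnt U V"
        using X unfolding Hausdorff_space_def by metis
      moreover from this have "disjnt (e ` U) (e ` V)"
        using inj by (auto simp: disjnt_def inj_eq)
      ultimately show ?thesis
        using 3 op_img by blast
    qed
  qed
  moreover have "embedding_map X Y e"
  proof (rule injective_open_imp_embedding_map)
    show "continuous_map X Y e"
      unfolding continuous_map_alt
    proof (intro conjI allI impI)
      fix S assume "openin Y S"
      then show "openin X (e -` S \<inter> topspace X)"
        unfolding Yop opn_def by auto
    qed (auto simp: topY)
    show "open_map X Y e"
      using op_img by (auto simp: open_map_def)
    show "inj_on e (topspace X)"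
      using inj inj_on_subset by blast
  qed
  ultimately have "closedin Y (e ` topspace X)"
    using closed unfolding H_closed_def by blast
  then have "openin Y (topspace Y - e ` topspace X)"
    by blast
  \<comment> \<open>So the singleton of \<open>w\<close> would be open, and its trace, the empty
    set, would include a member of \<open>B\<close>.\<close>
  moreover have "topspace Y - e ` topspace X = {w}"
    unfolding topY using ew by auto
  ultimately obtain U where "U \<in> B" "U \<subseteq> e -` {w}"
    unfolding Yop opn_def by auto
  then show False
    using Bn ew by blast
qed

section \<open>Regular spaces and compactness\<close>

text \<open>Regularity refines the cover to the open sets in \<open>K\<close>, whose closures still
  lie in members of \<open>C\<close>. The closure of a finite union is the union of the closures, so
  a finite subfamily of \<open>K\<close> with dense union yields a finite subcover from
  \<open>C\<close>.\<close>

lemma H_i_regular_imp_compact_space: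
  assumes "H_i X" "regular_space X"
  shows "compact_space X"
  unfolding compact_space_alt
proof (intro allI impI)
  fix C assume "(\<forall>U\<in>C. openin X U) \<and> topspace X \<subseteq> \<Union>C"
  then have C: "\<forall>U\<in>C. openin X U" "topspace X \<subseteq> \<Union>C"
    by auto
  define K where "K = {V. openin X V \<and> (\<exists>U\<in>C. X closure_of V \<subseteq> U)}"
  have "x \<in> \<Union>K" if x: "x \<in> topspace X" for x
  proof -
    obtain U where U: "U \<in> C" "x \<in> U"
      using C(2) x by auto
    have "closedin X (topspace X - U)"
      using C(1) U(1) by auto
    then obtain V W where VW: "openin X V" "openin X W" "x \<in> V" "topspace X - U \<subseteq> W" "disjnt V W"
      using \<open>regular_space X\<close> x U(2) unfolding regular_space_def by (metis DiffD2 DiffI)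
    then have "W \<inter> X closure_of V = {}"
      by (auto simp: openin_Int_closure_of_eq_empty disjnt_def)
    then have "X closure_of V \<subseteq> U"
      using VW(4) closure_of_subset_topspace[of X V] by blast
    then show ?thesis
      using VW U(1) by (auto simp: K_def)
  qed
  moreover have "\<Union>K \<subseteq> topspace X"
    using openin_subset by (auto simp: K_def)
  ultimately have "\<exists>F\<subseteq>K. finite F \<and> X closure_of (\<Union>F) = topspace X"
    by (intro H_i_finite_dense_subcover[OF \<open>H_i X\<close>]) (auto simp: K_def)
  then obtain F where F: "F \<subseteq> K" "finite F" "X closure_of (\<Union>F) = topspace X"
    by blast
  have "\<forall>V\<in>F. \<exists>U\<in>C. X closure_of V \<subseteq> U"
    using F(1) by (auto simp: K_def)
  then obtain u where u: "\<And>V. V \<in> F \<Longrightarrow> u V \<in> C \<and> X closure_of V \<subseteq> u V"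
    by metis
  have "topspace X = (\<Union>V\<in>F. X closure_of V)"
    using F closure_of_Union[of F X] by auto
  then have "topspace X \<subseteq> \<Union>(u ` F)"
    using u by blast
  moreover have "finite (u ` F)" "u ` F \<subseteq> C"
    using F(2) u by auto
  ultimately show "\<exists>F. finite F \<and> F \<subseteq> C \<and> topspace X \<subseteq> \<Union>F"
    by blast
qed

lemma compact_space_imp_weakly_initially_compact:
  assumes "compact_space X"
  shows "weakly_initially_compact l X"
  unfolding weakly_initially_compact_def
proof (intro allI impI)
  fix C assume C: "(\<forall>U\<in>C. openin X U) \<and> \<Union>C = topspace X \<and> |C| \<le>o l"
  then obtain F where F: "finite F" "F \<subseteq> C" "topspace X \<subseteq> \<Union>F"
    using assms unfolding compact_space_alt by (metis order_refl)
  then have "\<Union>F = topspace X"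
    using C Union_mono[of F C] by simp
  then show "\<exists>F. F \<subseteq> C \<and> finite F \<and> X closure_of (\<Union>F) = topspace X"
    using F by (metis closure_of_topspace)
qed

section \<open>Assembling the equivalences\<close>

lemma infinite_cardinal_card_of:
  assumes "infinite A"
  shows "infinite_cardinal |A|"
  using assms by (simp add: infinite_cardinal_def Field_card_of card_of_card_order_on)

theorem theorem5:
  fixes X :: "'a topology"
  shows
    "(H_i X \<longleftrightarrow>
        (\<forall>l :: ('a, 'b) universe rel. infinite_cardinal l \<longrightarrow> weakly_initially_compact l X)) \<and>
     (H_i X \<longleftrightarrow>
        (\<forall>(I :: ('a, 'b) universe set) D. ultrafilter_over I D \<longrightarrow> D_pseudocompact I D X)) \<and>
     (H_i X \<longleftrightarrow>
        (\<forall>l :: ('a, 'b) universe rel. infinite_cardinal l \<longrightarrow>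
           (\<exists>D. regular_ultrafilter_over l D \<and> D_pseudocompact (Field l) D X))) \<and>
     (Hausdorff_space X \<longrightarrow>
        (H_i X \<longleftrightarrow> H_closed TYPE(('a, 'b) universe) X)) \<and>
     (Hausdorff_space X \<and> regular_space X \<longrightarrow>
        (H_i X \<longleftrightarrow> compact_space X))"
proof -
  \<comment> \<open>Both \<open>?P2\<close> and \<open>?P4\<close> are applied only at this cardinal
    to recover H(i); it is large enough because the universe has \<open>'a set\<close> as a
    summand.\<close>
  let ?l = "|UNIV :: ('a, 'b) universe set|"
  let ?P2 = "\<forall>l :: ('a, 'b) universe rel. infinite_cardinal l \<longrightarrow> weakly_initially_compact l X"
  let ?P3 = "\<forall>(I :: ('a, 'b) universe set) D. ultrafilter_over I D \<longrightarrow> D_pseudocompact I D X"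
  let ?P4 = "\<forall>l :: ('a, 'b) universe rel. infinite_cardinal l \<longrightarrow>
           (\<exists>D. regular_ultrafilter_over l D \<and> D_pseudocompact (Field l) D X)"
  let ?P5 = "H_closed TYPE(('a, 'b) universe) X"
  have "infinite (UNIV :: ('a, 'b) universe set)"
    by simp
  then have inf: "infinite_cardinal ?l"
    by (rule infinite_cardinal_card_of)
  have "inj (\<lambda>A :: 'a set. Inr (Inl A) :: ('a, 'b) universe)"
    by (simp add: inj_def)
  then have le: "|UNIV :: 'a set set| \<le>o ?l"
    using card_of_ordLeqI by blast
  have 12: "H_i X \<Longrightarrow> ?P2"
    using H_i_finite_dense_subcover[of X] unfolding weakly_initially_compact_def by meson
  have 21: "?P2 \<Longrightarrow> H_i X"
    using weakly_initially_compact_imp_H_i[OF _ le] inf by blast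
  have 13: "H_i X \<Longrightarrow> ?P3"
    using H_i_imp_D_pseudocompact by blast
  have 34: "?P3 \<Longrightarrow> ?P4"
    using regular_ultrafilter_exists unfolding regular_ultrafilter_over_def by metis
  have 41: "?P4 \<Longrightarrow> H_i X"
    using regular_D_pseudocompact_imp_H_i[OF _ _ le] inf by blast
  have 15: "H_i X \<Longrightarrow> ?P5" if "Hausdorff_space X"
  proof -
    assume "H_i X"
    have "closedin Y (f ` topspace X)"
      if Y: "Hausdorff_space Y" and f: "embedding_map X Y f"
      for Y :: "('a, 'b) universe topology" and f
    proof (rule H_i_imp_closedin_continuous_image[OF \<open>H_i X\<close> Y])
      show "continuous_map X Y f"
        using homeomorphic_imp_continuous_map[OF f[unfolded embedding_map_def]]
        by (simp add: continuous_map_in_subtopology)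
    qed
    then show ?P5
      using that by (simp add: H_closed_def)
  qed
  \<comment> \<open>Points are embedded as singletons in the \<open>'a set\<close> summand, which
    leaves the natural number 0 free to serve as the added point.\<close>
  have e: "inj (\<lambda>x :: 'a. Inr (Inl {x}) :: ('a, 'b) universe)"
    "Inl 0 \<notin> range (\<lambda>x :: 'a. Inr (Inl {x}) :: ('a, 'b) universe)"
    by (auto simp: inj_def)
  have 51: "?P5 \<Longrightarrow> H_i X"
    by (rule H_closed_imp_H_i[OF _ e])
  have 16: "H_i X \<Longrightarrow> compact_space X" if "regular_space X"
    using that H_i_regular_imp_compact_space by blast
  have 61: "compact_space X \<Longrightarrow> H_i X"
    using compact_space_imp_weakly_initially_compact weakly_initially_compact_imp_H_i[OF _ le]
    by blast
  show ?thesis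
    using 12 21 13 34 41 15 51 16 61 by argo
qed

end
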